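(* Let $G$ and $H$ be finite abelian groups. Then $G\cong H$ if and only if there exist an integer $r\geq 1$ and integers $m_1,\dots,m_r,n_1,\dots,n_r\geq 2$ such that $\gcd(m_1,m_2,\dots,m_r)=\gcd(n_1,n_2,\dots,n_r)$ and the subgroup lattices $L(G^{m_i})$ and $L(H^{n_i})$ are isomorphic for every $i=1,\dots,r$.
   Context: For a group $K$, $L(K)$ denotes the lattice of all subgroups of $K$ ordered by inclusion, and $K^n$ denotes the direct product of $n$ copies of $K$. Isomorphism of subgroup lattices means isomorphism as lattices. *)

theory Defs
  imports "HOL-Algebra.Algebra"
begin

definition group_power :: "('a, 'c) monoid_scheme \<Rightarrow> nat \<Rightarrow> (nat \<Rightarrow> 'a) monoid" where
  "group_power K n = product_group {..<n} (\<lambda>_. K)"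

definition subgroup_lattice :: "('a, 'c) monoid_scheme \<Rightarrow> 'a set set" where
  "subgroup_lattice K = {A. subgroup A K}"

text \<open>Isomorphism of subgroup lattices: a bijection between the sets of subgroups
  which preserves and reflects inclusion (an order isomorphism, equivalently a
  lattice isomorphism).\<close>
definition subgroup_lattice_iso ::
  "('a, 'c) monoid_scheme \<Rightarrow> ('b, 'd) monoid_scheme \<Rightarrow> bool" where
  "subgroup_lattice_iso K M =
     (\<exists>f. bij_betw f (subgroup_lattice K) (subgroup_lattice M) \<and>
          (\<forall>A\<in>subgroup_lattice K. \<forall>B\<in>subgroup_lattice K. A \<subseteq> B \<longleftrightarrow> f A \<subseteq> f B))"

end

theory Submission
  imports Defs "HOL-Number_Theory.Cong"
begin

text \<open>
  In a finite abelian group the subgroups whose own subgroups form a chain are exactly the cyclic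
  subgroups of prime power order \<open>p\<^sup>k\<close>, and \<open>k + 1\<close> is the number of their subgroups. The prime \<open>p\<close>
  is visible in the lattice as soon as there are two subgroups \<open>P \<noteq> Q\<close> of order \<open>p\<close>, because the
  join of \<open>P\<close> and \<open>Q\<close> then has \<open>p + 3\<close> subgroups; this is where exponents at least \<open>2\<close> enter. Hence a
  lattice isomorphism preserves the orders of these chain subgroups, and by counting their generators it
  preserves the number of solutions of \<open>x\<^sup>q = 1\<close> for every prime power \<open>q\<close>. Writing \<open>a\<close> and \<open>b\<close>
  for these numbers in \<open>G\<close> and \<open>H\<close>, one gets \<open>a ^ m i = b ^ n i\<close> for all \<open>i\<close>, and equality
  of the gcds forces \<open>a = b\<close>. Finally these numbers determine a finite abelian group: split off
  a cyclic \<open>p\<close>-subgroup of maximal order from both groups and induct.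
\<close>

section \<open>Torsion counts determine finite abelian groups\<close>

hide_const (open) Divisibility.prime

section \<open>Complements of cyclic subgroups\<close>

lemma (in group) subgroup_nat_pow_closed:
  assumes "subgroup S G" "x \<in> S" shows "x [^] (n::nat) \<in> S"
  by (induction n) (use assms in \<open>auto simp: subgroup.one_closed subgroup.m_closed\<close>)

text \<open>The complement is a maximal subgroup \<open>M\<close> meeting the cyclic group trivially. An element \<open>x\<close>
  outside the product can be shifted by a power of \<open>g\<close> to some \<open>y\<close> whose least power in the product
  lies in \<open>M\<close>; adjoining \<open>y\<close> would then contradict maximality.\<close>
lemma (in comm_group) cyclic_subgroup_complement:
  assumes fin: "finite (carrier G)" and g: "g \<in> carrier G"
    and s: "coprime s (ord g)" and exp: "\<And>x. x \<in> carrier G \<Longrightarrow> x [^] (ord g * s) = \<one>"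
  obtains M where "subgroup M G" "M \<inter> generate G {g} = {\<one>}" "M <#> generate G {g} = carrier G"
proof -
  define C where "C = generate G {g}"
  have Csub: "subgroup C G"
    unfolding C_def using g by (intro generate_is_subgroup) auto
  have Cmem: "c \<in> C \<longleftrightarrow> (\<exists>j::nat. c = g [^] j)" for c
    unfolding C_def using generate_pow_on_finite_carrier[OF fin g] by auto
  define F where "F = {M. subgroup M G \<and> M \<inter> C = {\<one>}}"
  have "F \<subseteq> Pow (carrier G)"
    by (auto simp: F_def dest: subgroup.subset)
  then have finF: "finite F" using fin by (meson finite_Pow_iff finite_subset)
  have "{\<one>} \<in> F"
    using Csub by (auto simp: F_def triv_subgroup subgroup.one_closed)
  then obtain M where M: "M \<in> F" and max: "\<And>N. N \<in> F \<Longrightarrow> M \<subseteq> N \<Longrightarrow> N = M"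
    using finite_has_maximal[OF finF] by (metis empty_iff)
  have Msub: "subgroup M G" and MC: "M \<inter> C = {\<one>}" using M by (auto simp: F_def)
  note Mc = subgroup.mem_carrier[OF Msub] and Cc = subgroup.mem_carrier[OF Csub]
  have D: "subgroup (M <#> C) G" using mult_subgroups[OF Msub Csub] .
  have "x \<in> M <#> C" if x: "x \<in> carrier G" for x
  proof (rule ccontr)
    assume nx: "x \<notin> M <#> C"
    define k where "k = (LEAST k::nat. 0 < k \<and> x [^] k \<in> M <#> C)"
    have ord1: "ord g > 0" using ord_ge_1[OF fin g] by simp
    have "x [^] (ord x) \<in> M <#> C"
      using pow_ord_eq_1[OF x] subgroup.one_closed[OF D] by simp
    then have "\<exists>k::nat. 0 < k \<and> x [^] k \<in> M <#> C"
      using ord_ge_1[OF fin x] by (intro exI[of _ "ord x"]) auto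
    from LeastI_ex[OF this] have "0 < k \<and> x [^] k \<in> M <#> C"
      unfolding k_def .
    then have k0: "0 < k" and kD: "x [^] k \<in> M <#> C"
      by blast+
    have kdvd: "k dvd i" if i: "x [^] i \<in> M <#> C" for i :: nat
    proof -
      have "x [^] (k * (i div k)) \<in> M <#> C"
        using subgroup_nat_pow_closed[OF D kD] x by (simp add: nat_pow_pow)
      then have "inv (x [^] (k * (i div k))) \<otimes> x [^] i \<in> M <#> C"
        using i D by (meson subgroup.m_closed subgroup.m_inv_closed)
      moreover have "x [^] i = x [^] (k * (i div k)) \<otimes> x [^] (i mod k)"
        using x by (simp add: nat_pow_mult)
      ultimately have "x [^] (i mod k) \<in> M <#> C"
        using x by (simp add: m_assoc[symmetric])
      then have "i mod k = 0"
        using not_less_Least[of "i mod k" "\<lambda>k. 0 < k \<and> x [^] k \<in> M <#> C"] k0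
        unfolding k_def[symmetric] by auto
      then show ?thesis by auto
    qed
    from kD obtain m j where m: "m \<in> M" and mj: "x [^] k = m \<otimes> g [^] (j::nat)"
      by (auto simp: set_mult_def Cmem)
    \<comment> \<open>The aim is an \<open>l\<close> with k * l congruent to j modulo
      \<open>ord g\<close>, so that dividing \<open>x\<close> by \<open>g [^] l\<close> removes the
      \<open>C\<close>-part of \<open>x [^] k\<close>. Raising \<open>x [^] k\<close> to the power
      \<open>u\<close> gives the identity, so \<open>m [^] u\<close> is inverse to a power of
      \<open>g\<close>, lies in both \<open>M\<close> and \<open>C\<close>, and is trivial. Hence k
      divides j * s, and coprimality with \<open>s\<close> leaves gcd(k, ord g) dividing j, which is
      the solvability condition.\<close>
    have "k dvd ord g * s" using kdvd exp[OF x] subgroup.one_closed[OF D] by simp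
    then obtain u where u: "ord g * s = k * u" by blast
    have "\<one> = x [^] (k * u)" using exp[OF x] u by simp
    also have "\<dots> = m [^] u \<otimes> g [^] (j * u)"
      using x g Mc[OF m] by (simp add: nat_pow_pow[symmetric] mj nat_pow_distrib)
    finally have "m [^] u = inv (g [^] (j * u))"
      using g Mc[OF m] by (metis inv_equality nat_pow_closed)
    moreover have "m [^] u \<in> M" using subgroup_nat_pow_closed[OF Msub m] .
    moreover have "inv (g [^] (j * u)) \<in> C"
      using subgroup.m_inv_closed[OF Csub] Cmem by blast
    ultimately have "inv (g [^] (j * u)) = \<one>" using MC by auto
    then have "g [^] (j * u) = \<one>" using g by (metis inv_inv inv_one nat_pow_closed)
    then have "ord g dvd j * u" using g pow_eq_id by blast
    then have "ord g * k dvd j * (k * u)" by (simp add: mult.left_commute mult_dvd_mono)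
    then have "ord g * k dvd ord g * (j * s)" by (simp add: u[symmetric] ac_simps)
    then have "k dvd j * s" using ord1 by simp
    then have "gcd k (ord g) dvd j * s" by (meson dvd_trans gcd_dvd1)
    moreover have "coprime (gcd k (ord g)) s"
      using s by (meson coprime_commute coprime_divisors dvd_refl gcd_dvd2)
    ultimately have "gcd k (ord g) dvd j" by (simp add: coprime_dvd_mult_left_iff)
    then obtain l where l: "[k * l = j] (mod ord g)"
      using cong_solve_dvd_nat[of k "ord g" j] k0 by auto
    define y where "y = x \<otimes> inv (g [^] l)"
    have yc: "y \<in> carrier G" using x g by (simp add: y_def)
    have "int (ord g) dvd int j - int (k * l)"
      using l by (metis cong_int_iff cong_iff_dvd_diff cong_sym)
    then have "g [^] int (k * l) = g [^] int j" using int_pow_eq[OF g] by blast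
    then have gkl: "g [^] (k * l) = g [^] j" by (simp only: int_pow_int)
    have yk: "y [^] k = m"
      using x g Mc[OF m] gkl
      by (simp add: y_def nat_pow_distrib nat_pow_inv nat_pow_pow mult.commute mj m_assoc)
    have xy: "x = y \<otimes> g [^] l" using x g by (simp add: y_def m_assoc)
    have yD: "y \<notin> M"
    proof
      assume "y \<in> M"
      then have "x \<in> M <#> C" unfolding xy using Cmem by (auto simp: set_mult_def)
      with nx show False ..
    qed
    define Y where "Y = generate G {y}"
    have Ysub: "subgroup Y G" unfolding Y_def using yc by (intro generate_is_subgroup) auto
    have Ymem: "c \<in> Y \<longleftrightarrow> (\<exists>j::nat. c = y [^] j)" for c
      unfolding Y_def using generate_pow_on_finite_carrier[OF fin yc] by auto
    have N: "subgroup (M <#> Y) G" using mult_subgroups[OF Msub Ysub] .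
    have MN: "M \<subseteq> M <#> Y" using subgroup.one_closed[OF Ysub] Mc
      by (force simp: set_mult_def)
    have "y \<in> Y" using Ymem yc nat_pow_eone by metis
    then have yN: "y \<in> M <#> Y" using subgroup.one_closed[OF Msub] yc
      by (force simp: set_mult_def)
    \<comment> \<open>If m' * y^i lies in \<open>C\<close> then x^i lies in \<open>M <#> C\<close>,
      so k divides i and y^i is a power of \<open>y [^] k = m\<close>. The element therefore lies in
      \<open>M\<close> as well.\<close>
    have "(M <#> Y) \<inter> C \<subseteq> {\<one>}"
    proof
      fix c assume "c \<in> (M <#> Y) \<inter> C"
      then obtain m' i where m': "m' \<in> M" and c: "c = m' \<otimes> y [^] (i::nat)" and cC: "c \<in> C"
        by (auto simp: set_mult_def Ymem)
      have "x [^] i = y [^] i \<otimes> g [^] (l * i)"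
        using yc g by (subst xy) (simp add: nat_pow_distrib nat_pow_pow)
      also have "y [^] i = inv m' \<otimes> c"
        using c yc Mc[OF m'] by (simp add: m_assoc[symmetric])
      finally have "x [^] i = inv m' \<otimes> (c \<otimes> g [^] (l * i))"
        using g Mc[OF m'] Cc[OF cC] by (simp add: m_assoc)
      moreover have "c \<otimes> g [^] (l * i) \<in> C"
        using subgroup.m_closed[OF Csub cC] Cmem by blast
      ultimately have "x [^] i \<in> M <#> C"
        using subgroup.m_inv_closed[OF Msub m'] by (auto simp: set_mult_def)
      then obtain t where "i = k * t" using kdvd by blast
      then have "y [^] i = m [^] t" using yc by (simp add: nat_pow_pow[symmetric] yk)
      then have "c \<in> M" using c m' subgroup_nat_pow_closed[OF Msub m] 
        by (simp add: subgroup.m_closed[OF Msub])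
      then show "c \<in> {\<one>}" using cC MC by auto
    qed
    then have "M <#> Y \<in> F"
      using N Csub by (auto simp: F_def subgroup.one_closed)
    then have "M <#> Y = M" using max MN by blast
    then show False using yN yD by simp
  qed
  then have "M <#> C = carrier G"
    using subgroup.subset[OF D] by blast
  then show thesis using that Msub MC by (simp add: C_def)
qed

section \<open>Counting the solutions of x^n = 1\<close>

definition torsion_count :: "('a, 'c) monoid_scheme \<Rightarrow> nat \<Rightarrow> nat" where
  "torsion_count G n = card {x \<in> carrier G. x [^]\<^bsub>G\<^esub> n = \<one>\<^bsub>G\<^esub>}"

lemma (in group) torsion_count_pos:
  assumes "finite (carrier G)" shows "torsion_count G n > 0"
proof -
  have "\<one> \<in> {x \<in> carrier G. x [^] n = \<one>}" by simp
  moreover have "finite {x \<in> carrier G. x [^] n = \<one>}" using assms by simp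
  ultimately show ?thesis unfolding torsion_count_def card_gt_0_iff by blast
qed

lemma torsion_count_iso:
  assumes "group G" "group H" "G \<cong> H"
  shows "torsion_count G n = torsion_count H n"
proof -
  obtain h where h: "h \<in> iso G H" using assms(3) by (auto simp: is_iso_def)
  interpret group_hom G H h
    using assms(1,2) h by (auto simp: group_hom_def group_hom_axioms_def iso_def)
  have bij: "bij_betw h (carrier G) (carrier H)" using h by (simp add: iso_def)
  have "x [^]\<^bsub>G\<^esub> n = \<one>\<^bsub>G\<^esub> \<longleftrightarrow> h x [^]\<^bsub>H\<^esub> n = \<one>\<^bsub>H\<^esub>" if "x \<in> carrier G" for x
  proof -
    have "h x [^]\<^bsub>H\<^esub> n = h (x [^]\<^bsub>G\<^esub> n)" using that by (simp add: hom_nat_pow)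
    then show ?thesis using bij that
      by (metis G.nat_pow_closed G.one_closed bij_betw_imp_inj_on hom_one inj_onD)
  qed
  then have "bij_betw h {x \<in> carrier G. x [^]\<^bsub>G\<^esub> n = \<one>\<^bsub>G\<^esub>} {x \<in> carrier H. x [^]\<^bsub>H\<^esub> n = \<one>\<^bsub>H\<^esub>}"
  proof (intro bij_betw_imageI)
    assume iff: "\<And>x. x \<in> carrier G \<Longrightarrow> x [^]\<^bsub>G\<^esub> n = \<one>\<^bsub>G\<^esub> \<longleftrightarrow> h x [^]\<^bsub>H\<^esub> n = \<one>\<^bsub>H\<^esub>"
    show "inj_on h {x \<in> carrier G. x [^]\<^bsub>G\<^esub> n = \<one>\<^bsub>G\<^esub>}"
      using bij_betw_imp_inj_on[OF bij] by (rule inj_on_subset) blast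
    show "h ` {x \<in> carrier G. x [^]\<^bsub>G\<^esub> n = \<one>\<^bsub>G\<^esub>} = {x \<in> carrier H. x [^]\<^bsub>H\<^esub> n = \<one>\<^bsub>H\<^esub>}"
      unfolding bij_betw_imp_surj_on[OF bij, symmetric] by (auto simp: iff)
  qed
  then show ?thesis unfolding torsion_count_def by (rule bij_betw_same_card)
qed

lemma DirProd_nat_pow:
  "(x, y) [^]\<^bsub>G \<times>\<times> H\<^esub> (n::nat) = (x [^]\<^bsub>G\<^esub> n, y [^]\<^bsub>H\<^esub> n)"
  by (induction n) (simp_all add: nat_pow_def)

lemma torsion_count_DirProd:
  "torsion_count (G \<times>\<times> H) n = torsion_count G n * torsion_count H n"
proof -
  have "{z \<in> carrier (G \<times>\<times> H). z [^]\<^bsub>G \<times>\<times> H\<^esub> n = \<one>\<^bsub>G \<times>\<times> H\<^esub>} =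
    {x \<in> carrier G. x [^]\<^bsub>G\<^esub> n = \<one>\<^bsub>G\<^esub>} \<times> {x \<in> carrier H. x [^]\<^bsub>H\<^esub> n = \<one>\<^bsub>H\<^esub>}"
    by (auto simp: DirProd_nat_pow)
  then show ?thesis by (simp add: torsion_count_def card_cartesian_product)
qed

lemma product_group_nat_pow:
  "x \<in> (\<Pi>\<^sub>E i\<in>I. carrier (G i)) \<Longrightarrow> x [^]\<^bsub>product_group I G\<^esub> (n::nat) = (\<lambda>i\<in>I. x i [^]\<^bsub>G i\<^esub> n)"
  by (induction n) (auto simp: nat_pow_def restrict_def)

lemma torsion_count_product_group:
  assumes "finite I"
  shows "torsion_count (product_group I G) n = (\<Prod>i\<in>I. torsion_count (G i) n)"
proof -
  have "{x \<in> carrier (product_group I G). x [^]\<^bsub>product_group I G\<^esub> n = \<one>\<^bsub>product_group I G\<^esub>} =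
    (\<Pi>\<^sub>E i\<in>I. {x \<in> carrier (G i). x [^]\<^bsub>G i\<^esub> n = \<one>\<^bsub>G i\<^esub>})"
    by (auto simp: product_group_nat_pow PiE_iff restrict_def fun_eq_iff extensional_def)
  then show ?thesis by (simp add: torsion_count_def card_PiE assms)
qed

text \<open>The solution sets for \<open>p ^ k\<close> and \<open>p ^ Suc k\<close> are nested, and
  an order dividing the larger power but not the smaller one must be the larger power. Thus the
  torsion counts decide which prime powers occur as orders of elements.\<close>

lemma (in group) ex_ord_prime_power_iff:
  assumes fin: "finite (carrier G)" and p: "prime p"
  shows "(\<exists>x\<in>carrier G. ord x = p ^ Suc k) \<longleftrightarrow> torsion_count G (p ^ k) \<noteq> torsion_count G (p ^ Suc k)"
proof -
  let ?T = "\<lambda>k. {x \<in> carrier G. x [^] (p ^ k) = \<one>}"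
  have sub: "?T k \<subseteq> ?T (Suc k)"
    by (auto simp: pow_eq_id intro: dvd_trans)
  have "(\<exists>x\<in>carrier G. ord x = p ^ Suc k) \<longleftrightarrow> ?T k \<noteq> ?T (Suc k)"
  proof
    assume "\<exists>x\<in>carrier G. ord x = p ^ Suc k"
    then obtain x where "x \<in> carrier G" "ord x = p ^ Suc k" by blast
    then have "x \<in> ?T (Suc k)" "x \<notin> ?T k"
      using p by (auto simp: pow_eq_id dvd_power_iff_le prime_ge_2_nat simp del: power_Suc)
    then show "?T k \<noteq> ?T (Suc k)" by blast
  next
    assume "?T k \<noteq> ?T (Suc k)"
    with sub obtain x where x: "x \<in> carrier G" "ord x dvd p ^ Suc k" "\<not> ord x dvd p ^ k"
      using pow_eq_id by blast
    then obtain i where "i \<le> Suc k" "ord x = p ^ i"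
      using divides_primepow_nat[OF p] by blast
    with x show "\<exists>x\<in>carrier G. ord x = p ^ Suc k"
      by (metis le_SucE le_imp_power_dvd)
  qed
  also have "\<dots> \<longleftrightarrow> card (?T k) \<noteq> card (?T (Suc k))"
    using card_subset_eq[OF _ sub] fin by auto
  finally show ?thesis by (simp add: torsion_count_def)
qed

lemma (in group) ex_ord_prime:
  assumes fin: "finite (carrier G)" and "x \<in> carrier G" "x \<noteq> \<one>"
  obtains p y where "prime p" "y \<in> carrier G" "ord y = (p::nat)"
proof -
  have "ord x \<noteq> 1" using assms ord_eq_1 by blast
  then obtain p where p: "prime p" "p dvd ord x" using prime_factor_nat by blast
  have "ord x div p dvd ord x" "ord x div p \<noteq> 0"
    using p ord_ge_1[OF fin assms(2)] by (auto simp: div_dvd_iff_mult dvd_div_eq_0_iff)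
  then have "ord (x [^] (ord x div p)) = ord x div (ord x div p)"
    using ord_pow assms(2) by blast
  also have "\<dots> = p" using p ord_ge_1[OF fin assms(2)]
    by (metis dvd_mult_div_cancel nonzero_mult_div_cancel_right \<open>ord x div p \<noteq> 0\<close>)
  finally show thesis using that p(1) assms(2) by blast
qed

section \<open>Splitting off cyclic factors and induction on the order\<close>

text \<open>Write the group order as p^a * s with p not dividing s. Every \<open>x [^] s\<close> has
  p-power order, which divides \<open>ord g\<close> by maximality; so \<open>ord g * s\<close> is an
  exponent of the group with s coprime to \<open>ord g\<close>, and
  \<open>cyclic_subgroup_complement\<close> applies.\<close>

lemma (in comm_group) split_off_maximal_cyclic_p_subgroup:
  assumes fin: "finite (carrier G)" and p: "prime p" and g: "g \<in> carrier G" "ord g = p ^ k"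
    and max: "\<And>x j. x \<in> carrier G \<Longrightarrow> ord x = p ^ j \<Longrightarrow> j \<le> k"
  obtains M where "subgroup M G"
    "subgroup_generated G M \<times>\<times> subgroup_generated G {g} \<cong> G"
proof -
  have "order G \<noteq> 0" using fin order_gt_0_iff_finite by simp
  then obtain a s where a: "order G = p ^ a * s" and s: "\<not> p dvd s"
    using p multiplicity_decompose'[of "order G" p] by (metis not_prime_unit)
  have "coprime s (ord g)"
    using p s g by (simp add: coprime_commute prime_imp_coprime)
  moreover have "x [^] (ord g * s) = \<one>" if x: "x \<in> carrier G" for x
  proof -
    have "(x [^] s) [^] (p ^ a) = \<one>"
      using x pow_order_eq_1[OF x] by (simp add: nat_pow_pow a mult.commute)
    then have "ord (x [^] s) dvd p ^ a" using x pow_eq_id by simp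
    then obtain j where "ord (x [^] s) = p ^ j" using p divides_primepow_nat by blast
    with max[of "x [^] s" j] x have "ord (x [^] s) dvd ord g" by (simp add: g(2) le_imp_power_dvd)
    then show ?thesis using x by (metis mult.commute nat_pow_closed nat_pow_pow pow_eq_id)
  qed
  ultimately obtain M where M: "subgroup M G" "M \<inter> generate G {g} = {\<one>}" "M <#> generate G {g} = carrier G"
    using cyclic_subgroup_complement[OF fin g(1)] by blast
  have C: "subgroup (generate G {g}) G" using g by (intro generate_is_subgroup) auto
  interpret group_disjoint_sum G M "generate G {g}"
    using M(1) C by (simp add: group_disjoint_sum_def)
  have "subgroup_generated G M \<times>\<times> subgroup_generated G (generate G {g}) \<cong> G"
    using iso_group_mul[OF comm_group_axioms] M unfolding is_iso_def by blast
  moreover have "subgroup_generated G (generate G {g}) = subgroup_generated G {g}"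
    using g(1) subgroup_generated2[of "{g}"] 
    by (metis C carrier_subgroup_generated empty_subsetI generate_incl insert_subset inf.absorb2 subgroup_generated_def subgroup.carrier_subgroup_generated_subgroup)
  ultimately show thesis using that M(1) by simp
qed

lemma isomorphic_cyclic_subgroups:
  assumes "group G" "group H" and g: "g \<in> carrier G" and h: "h \<in> carrier H"
    and ord_eq: "group.ord G g = group.ord H h"
  shows "subgroup_generated G {g} \<cong> subgroup_generated H {h}"
proof -
  interpret G: group G by fact
  interpret H: group H by fact
  \<comment> \<open>The chosen exponent is irrelevant: two exponents give the same power of
    \<open>g\<close> exactly when their difference is divisible by the common order, hence exactly
    when they give the same power of \<open>h\<close>.\<close>
  define f where "f c = h [^]\<^bsub>H\<^esub> (SOME i::int. c = g [^]\<^bsub>G\<^esub> i)" for c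
  have f: "f (g [^]\<^bsub>G\<^esub> i) = h [^]\<^bsub>H\<^esub> i" for i :: int
  proof -
    have "g [^]\<^bsub>G\<^esub> i = g [^]\<^bsub>G\<^esub> (SOME j::int. g [^]\<^bsub>G\<^esub> i = g [^]\<^bsub>G\<^esub> j)"
      by (rule someI) simp
    then show ?thesis
      unfolding f_def using G.int_pow_eq[OF g] H.int_pow_eq[OF h] ord_eq by metis
  qed
  have "f \<in> iso (subgroup_generated G {g}) (subgroup_generated H {h})"
  proof (rule isoI)
    show "f \<in> hom (subgroup_generated G {g}) (subgroup_generated H {h})"
      using g h by (intro homI)
        (auto simp: G.carrier_subgroup_generated_by_singleton H.carrier_subgroup_generated_by_singleton f
          simp flip: G.int_pow_mult H.int_pow_mult)
    show "bij_betw f (carrier (subgroup_generated G {g})) (carrier (subgroup_generated H {h}))"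
      using g h G.int_pow_eq[OF g] H.int_pow_eq[OF h] ord_eq
      by (auto simp: bij_betw_def inj_on_def G.carrier_subgroup_generated_by_singleton
          H.carrier_subgroup_generated_by_singleton f image_image)
  qed
  then show ?thesis by (auto simp: is_iso_def)
qed

text \<open>Equal counts force equal maximal exponents of p-power orders, so isomorphic cyclic
  factors can be split off on both sides. Torsion counts are multiplicative over direct products,
  and the positive counts of the cyclic factors cancel, so the complements satisfy the same
  hypothesis.\<close>

lemma iso_of_torsion_counts:
  fixes G :: "'a monoid" and H :: "'b monoid"
  assumes "comm_group G" "finite (carrier G)" "comm_group H" "finite (carrier H)"
    and "\<And>p k. prime p \<Longrightarrow> torsion_count G (p ^ k) = torsion_count H (p ^ k)"
  shows "G \<cong> H"
  using assms
proof (induction "order G" arbitrary: G H rule: less_induct)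
  case less
  interpret G: comm_group G by fact
  interpret H: comm_group H by fact
  note finG = less.prems(2) and finH = less.prems(4)
  have ex_iff: "(\<exists>x\<in>carrier G. G.ord x = p ^ k) \<longleftrightarrow> (\<exists>x\<in>carrier H. H.ord x = p ^ k)"
    if p: "prime p" for p k
  proof (cases k)
    case 0
    have "\<exists>x\<in>carrier G. G.ord x = p ^ k" by (rule bexI[of _ "\<one>\<^bsub>G\<^esub>"]) (simp_all add: 0)
    moreover have "\<exists>x\<in>carrier H. H.ord x = p ^ k" by (rule bexI[of _ "\<one>\<^bsub>H\<^esub>"]) (simp_all add: 0)
    ultimately show ?thesis by simp
  next
    case (Suc j)
    show ?thesis
      unfolding Suc G.ex_ord_prime_power_iff[OF finG p] H.ex_ord_prime_power_iff[OF finH p] less.prems(5)[OF p] ..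
  qed
  show ?case
  proof (cases "carrier G = {\<one>\<^bsub>G\<^esub>} \<and> carrier H = {\<one>\<^bsub>H\<^esub>}")
    case True
    then have "(\<lambda>_. \<one>\<^bsub>H\<^esub>) \<in> iso G H"
      by (auto intro!: isoI homI simp: bij_betw_def)
    then show ?thesis by (auto simp: is_iso_def)
  next
    case False
    \<comment> \<open>A nontrivial element of either group suffices, since \<open>ex_iff\<close>
      carries a prime order from \<open>H\<close> over to \<open>G\<close>.\<close>
    then have "\<exists>p y. prime p \<and> y \<in> carrier G \<and> G.ord y = (p::nat)"
    proof (cases "carrier G = {\<one>\<^bsub>G\<^esub>}")
      case True
      with False obtain x where "x \<in> carrier H" "x \<noteq> \<one>\<^bsub>H\<^esub>" using H.one_closed by blast
      then obtain p y where "prime p" "y \<in> carrier H" "H.ord y = (p::nat)"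
        using H.ex_ord_prime[OF finH] by metis
      then show ?thesis using ex_iff[of p 1] by auto
    next
      case False
      then obtain x where "x \<in> carrier G" "x \<noteq> \<one>\<^bsub>G\<^esub>" using G.one_closed by blast
      then show ?thesis using G.ex_ord_prime[OF finG] by metis
    qed
    then obtain p :: nat and y where p: "prime p" and y: "y \<in> carrier G" "G.ord y = p" by blast
    define K where "K = {k. \<exists>x\<in>carrier G. G.ord x = p ^ k}"
    have "finite ((\<lambda>k. p ^ k) -` (G.ord ` carrier G))"
      using finG prime_gt_1_nat[OF p] by (intro finite_vimageI finite_imageI injI) simp_all
    moreover have "K \<subseteq> (\<lambda>k. p ^ k) -` (G.ord ` carrier G)" unfolding K_def by force
    ultimately have finK: "finite K" by (rule rev_finite_subset)
    have K1: "1 \<in> K" using y by (auto simp: K_def)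
    \<comment> \<open>By \<open>ex_iff\<close> the set \<open>K\<close> is the same for
      \<open>H\<close>, so a single k serves both groups.\<close>
    define k where "k = Max K"
    have kK: "k \<in> K" using finK K1 Max_in unfolding k_def by blast
    have kmax: "j \<le> k" if "j \<in> K" for j using that finK unfolding k_def by simp
    have k1: "1 \<le> k" using kmax K1 .
    have KH: "K = {k. \<exists>x\<in>carrier H. H.ord x = p ^ k}" using ex_iff[OF p] by (simp add: K_def)
    obtain g where g: "g \<in> carrier G" "G.ord g = p ^ k" using kK by (auto simp: K_def)
    obtain h where h: "h \<in> carrier H" "H.ord h = p ^ k" using kK by (auto simp: KH)
    have "\<And>x j. x \<in> carrier G \<Longrightarrow> G.ord x = p ^ j \<Longrightarrow> j \<le> k" using kmax by (auto simp: K_def)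
    then obtain M where M: "subgroup M G" and isoM: "subgroup_generated G M \<times>\<times> subgroup_generated G {g} \<cong> G"
      using G.split_off_maximal_cyclic_p_subgroup[OF finG p g] by blast
    have "\<And>x j. x \<in> carrier H \<Longrightarrow> H.ord x = p ^ j \<Longrightarrow> j \<le> k" using kmax by (auto simp: KH)
    then obtain N where N: "subgroup N H" and isoN: "subgroup_generated H N \<times>\<times> subgroup_generated H {h} \<cong> H"
      using H.split_off_maximal_cyclic_p_subgroup[OF finH p h] by blast
    let ?A = "subgroup_generated G M" and ?C = "subgroup_generated G {g}"
    let ?B = "subgroup_generated H N" and ?D = "subgroup_generated H {h}"
    have finA: "finite (carrier ?A)"
      using finG G.carrier_subgroup_generated_subset finite_subset by blast
    have finB: "finite (carrier ?B)" and finD: "finite (carrier ?D)"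
      using finH H.carrier_subgroup_generated_subset finite_subset by blast+
    have CD: "?C \<cong> ?D"
      using isomorphic_cyclic_subgroups[OF G.is_group H.is_group] g h by simp
    have gr: "group (?A \<times>\<times> ?C)" "group (?B \<times>\<times> ?D)" by (simp_all add: DirProd_group)
    have "?A \<cong> ?B"
    proof (rule less.hyps)
      have "card (carrier ?C) = p ^ k"
        using G.cyclic_order_is_ord[OF g(1)] g by (simp add: order_def)
      moreover have "order G = order ?A * card (carrier ?C)"
        using iso_same_card[OF isoM] by (simp add: order_def card_cartesian_product)
      \<comment> \<open>The cyclic factor is nontrivial because k is at least 1; this makes the
        complement strictly smaller.\<close>
      moreover have "p ^ k > 1" using one_less_power[OF prime_gt_1_nat[OF p]] k1 by simp
      moreover have "order ?A > 0" using finA monoid.order_gt_0_iff_finite[OF group.is_monoid[OF G.group_subgroup_generated]] by blast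
      ultimately show "order ?A < order G" using n_less_m_mult_n[of "order ?A" "p ^ k"] by (simp add: mult.commute)
      show "comm_group ?A" "comm_group ?B"
        using G.abelian_subgroup_generated H.abelian_subgroup_generated
          G.comm_group_axioms H.comm_group_axioms by blast+
      show "finite (carrier ?A)" "finite (carrier ?B)" by fact+
      fix q k assume q: "prime (q::nat)"
      have "torsion_count ?A (q ^ k) * torsion_count ?C (q ^ k) = torsion_count G (q ^ k)"
        using torsion_count_iso[OF gr(1) G.is_group isoM] by (simp add: torsion_count_DirProd)
      moreover have "torsion_count ?B (q ^ k) * torsion_count ?D (q ^ k) = torsion_count H (q ^ k)"
        using torsion_count_iso[OF gr(2) H.is_group isoN] by (simp add: torsion_count_DirProd)
      moreover have "torsion_count ?C (q ^ k) = torsion_count ?D (q ^ k)"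
        by (intro torsion_count_iso CD) auto
      moreover have "torsion_count ?D (q ^ k) > 0" using group.torsion_count_pos[OF H.group_subgroup_generated finD] .
      ultimately show "torsion_count ?A (q ^ k) = torsion_count ?B (q ^ k)"
        unfolding less.prems(5)[OF q, symmetric] using mult_right_cancel by (metis less_numeral_extra(3) less.prems(5)[OF q])
    qed
    then have "?A \<times>\<times> ?C \<cong> ?B \<times>\<times> ?D"
      using group.DirProd_iso_trans CD by (metis G.group_subgroup_generated)
    then show ?thesis using isoM isoN gr
      by (meson group.iso_sym iso_trans)
  qed
qed

section \<open>Chain subgroups and joins of subgroups of prime order\<close>

definition subgroups_below :: "('a, 'c) monoid_scheme \<Rightarrow> 'a set \<Rightarrow> 'a set set" where
  "subgroups_below G A = {B. subgroup B G \<and> B \<subseteq> A}"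

text \<open>Phrased through inclusions of subgroups alone, so that every lattice isomorphism
  respects it.\<close>

definition chain_subgroup :: "('a, 'c) monoid_scheme \<Rightarrow> 'a set \<Rightarrow> bool" where
  "chain_subgroup G C \<longleftrightarrow> subgroup C G \<and>
     (\<forall>A\<in>subgroups_below G C. \<forall>B\<in>subgroups_below G C. A \<subseteq> B \<or> B \<subseteq> A)"

lemma (in group) generate_singleton_subgroup: "x \<in> carrier G \<Longrightarrow> subgroup (generate G {x}) G"
  by (intro generate_is_subgroup) auto

lemma (in group) generate_singleton_subset_iff:
  assumes "subgroup B G" "x \<in> carrier G"
  shows "generate G {x} \<subseteq> B \<longleftrightarrow> x \<in> B"
  using generate_subgroup_incl[OF _ assms(1), of "{x}"] generate.incl[of x "{x}" G] by auto

lemma (in group) mem_generate_singleton_iff: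
  assumes "finite (carrier G)" "x \<in> carrier G"
  shows "y \<in> generate G {x} \<longleftrightarrow> (\<exists>j::nat. y = x [^] j)"
  using generate_pow_on_finite_carrier[OF assms] by auto

lemma (in group) generate_one_eq: "generate G {\<one>} = {\<one>}"
  using generate_singleton_subset_iff[OF triv_subgroup one_closed] generate.one by auto

lemma (in group) finite_subgroup: "finite (carrier G) \<Longrightarrow> subgroup B G \<Longrightarrow> finite B"
  using finite_subset subgroup.subset by blast

lemma (in group) card_subgroup_dvd:
  assumes fin: "finite (carrier G)" and A: "subgroup A G" and B: "subgroup B G" and "A \<subseteq> B"
  shows "card A dvd card B"
proof -
  interpret B: group "G\<lparr>carrier := B\<rparr>" using subgroup_imp_group[OF B] .
  have AB: "subgroup A (G\<lparr>carrier := B\<rparr>)" using subgroup_incl[OF A B assms(4)] .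
  have "card A dvd order (G\<lparr>carrier := B\<rparr>)" unfolding B.lagrange[OF AB, symmetric] by simp
  then show ?thesis by (simp add: order_def)
qed

lemma (in group) finite_subgroups_below:
  assumes "finite (carrier G)" shows "finite (subgroups_below G A)"
proof -
  have "subgroups_below G A \<subseteq> Pow (carrier G)"
    by (auto simp: subgroups_below_def dest: subgroup.subset)
  then show ?thesis using assms by (meson finite_Pow_iff finite_subset)
qed

text \<open>Every subgroup of the group generated by x, except that group itself, lies in the one
  generated by x^p: an element outside the latter is x^j with p not dividing j, and so generates
  everything. Each induction step therefore puts one new top on a chain.\<close>

lemma (in group) subgroups_below_cyclic_p_group:
  assumes fin: "finite (carrier G)" and p: "prime p"
  shows "x \<in> carrier G \<Longrightarrow> ord x = p ^ k \<Longrightarrow>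
    chain_subgroup G (generate G {x}) \<and> card (subgroups_below G (generate G {x})) = Suc k"
proof (induction k arbitrary: x)
  case 0
  then have "x = \<one>" using ord_eq_1 by auto
  then have "generate G {x} = {\<one>}" using generate_one_eq by simp
  moreover have "subgroups_below G {\<one>} = {{\<one>}}"
    using triv_subgroup subgroup.one_closed by (auto simp: subgroups_below_def)
  ultimately show ?case using triv_subgroup by (simp add: chain_subgroup_def)
next
  case (Suc k)
  note x = Suc.prems(1)
  define y where "y = x [^] p"
  have yc: "y \<in> carrier G" using x by (simp add: y_def)
  have p0: "p > 0" using prime_gt_0_nat[OF p] .
  have "ord y = ord x div p" unfolding y_def
    by (rule ord_pow[OF x]) (use Suc.prems(2) p0 in auto)
  then have ordy: "ord y = p ^ k" using Suc.prems(2) p0 by simp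
  let ?X = "generate G {x}" and ?Y = "generate G {y}"
  have Xs: "subgroup ?X G" and Ys: "subgroup ?Y G"
    using x yc generate_singleton_subgroup by auto
  have "y \<in> ?X" using mem_generate_singleton_iff[OF fin x] y_def by blast
  then have YX: "?Y \<subseteq> ?X" using generate_singleton_subset_iff[OF Xs yc] by simp
  have "card ?Y < card ?X"
    unfolding generate_pow_card[OF x, symmetric] generate_pow_card[OF yc, symmetric] ordy Suc.prems(2)
    using prime_gt_1_nat[OF p] by (intro power_strict_increasing) simp_all
  then have nXY: "\<not> ?X \<subseteq> ?Y" using finite_subgroup[OF fin Ys] by (meson card_mono linorder_not_le)
  have "B = ?X" if B: "subgroup B G" "B \<subseteq> ?X" "\<not> B \<subseteq> ?Y" for B
  proof -
    from B obtain b where b: "b \<in> B" "b \<notin> ?Y" by blast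
    have bc: "b \<in> carrier G" using B(1) b(1) by (rule subgroup.mem_carrier)
    from b B obtain j :: nat where j: "b = x [^] j"
      using mem_generate_singleton_iff[OF fin x] by blast
    have "\<not> p dvd j"
    proof
      assume "p dvd j"
      then obtain t where "j = p * t" by blast
      then have "b = y [^] t" using j x by (simp add: y_def nat_pow_pow)
      then show False using b(2) mem_generate_singleton_iff[OF fin yc] by blast
    qed
    then have "coprime j p" using prime_imp_coprime[OF p] coprime_commute by blast
    then have "coprime j (ord x)" unfolding Suc.prems(2) by simp
    then have "ord b = ord x" using pow_ord_eq_ord_iff[OF fin x] j by simp
    then have "card (generate G {b}) = card ?X"
      using generate_pow_card[OF x] generate_pow_card[OF bc] by simp
    moreover have "generate G {b} \<subseteq> ?X"
      using generate_singleton_subset_iff[OF Xs bc] b(1) B(2) by blast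
    ultimately have "generate G {b} = ?X" using card_subset_eq finite_subgroup[OF fin Xs] by blast
    moreover have "generate G {b} \<subseteq> B" using generate_singleton_subset_iff[OF B(1) bc] b(1) by simp
    ultimately show ?thesis using B(2) by blast
  qed
  then have eq: "subgroups_below G ?X = insert ?X (subgroups_below G ?Y)"
    using Xs YX by (auto simp: subgroups_below_def)
  have IH: "chain_subgroup G ?Y" "card (subgroups_below G ?Y) = Suc k"
    using Suc.IH[OF yc ordy] by auto
  have "?X \<notin> subgroups_below G ?Y" using nXY by (simp add: subgroups_below_def)
  then have "card (subgroups_below G ?X) = Suc (Suc k)"
    unfolding eq using IH(2) finite_subgroups_below[OF fin] by simp
  moreover have "chain_subgroup G ?X"
    unfolding chain_subgroup_def
  proof (intro conjI ballI Xs)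
    fix A B assume AB: "A \<in> subgroups_below G ?X" "B \<in> subgroups_below G ?X"
    show "A \<subseteq> B \<or> B \<subseteq> A"
    proof (cases "A = ?X \<or> B = ?X")
      case True
      then show ?thesis using AB by (auto simp: subgroups_below_def)
    next
      case False
      then have "A \<in> subgroups_below G ?Y" "B \<in> subgroups_below G ?Y" using AB eq by auto
      then show ?thesis using IH(1) by (simp add: chain_subgroup_def)
    qed
  qed
  ultimately show ?case by simp
qed

lemma prime_powerI_nat:
  fixes n :: nat
  assumes "n > 0" and eq: "\<And>p q. prime p \<Longrightarrow> prime q \<Longrightarrow> p dvd n \<Longrightarrow> q dvd n \<Longrightarrow> p = q"
  obtains p k where "prime p" "n = p ^ k"
proof (cases "n = 1")
  case True
  \<comment> \<open>The number 1 is the zeroth power of any prime; 2 is an arbitrary choice.\<close>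
  then show thesis using that[of 2 0] two_is_prime_nat by simp
next
  case False
  then obtain p where p: "prime p" "p dvd n" using prime_factor_nat by blast
  obtain a s where a: "n = p ^ a * s" and s: "\<not> p dvd s"
    using p assms(1) multiplicity_decompose'[of n p] by (metis not_prime_unit neq0_conv)
  have "s = 1"
  proof (rule ccontr)
    assume "s \<noteq> 1"
    then obtain q where q: "prime q" "q dvd s" using prime_factor_nat by blast
    then have "q = p" using eq[OF q(1) p(1)] p(2) a by simp
    then show False using q s by simp
  qed
  then show thesis using that[OF p(1)] a by simp
qed

text \<open>An element of maximal order generates \<open>C\<close>, because the cyclic subgroups of
  \<open>C\<close> are comparable. If primes p and q divide its order, the cyclic subgroups of
  orders p and q inside \<open>C\<close> are comparable too, so one prime divides the other by
  Lagrange and p = q.\<close>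

lemma (in group) chain_subgroupE:
  assumes fin: "finite (carrier G)" and C: "chain_subgroup G C"
  obtains x p k where "x \<in> carrier G" "prime p" "ord x = p ^ k" "C = generate G {x}"
proof -
  have Cs: "subgroup C G" using C by (simp add: chain_subgroup_def)
  note Cc = subgroup.mem_carrier[OF Cs]
  have chain: "A \<subseteq> B \<or> B \<subseteq> A" if "subgroup A G" "A \<subseteq> C" "subgroup B G" "B \<subseteq> C" for A B
    using C that by (auto simp: chain_subgroup_def subgroups_below_def)
  have gC: "subgroup (generate G {y}) G" "generate G {y} \<subseteq> C" if "y \<in> C" for y
    using generate_singleton_subgroup generate_singleton_subset_iff[OF Cs] Cc[OF that] that by auto
  have finC: "finite C" using finite_subgroup[OF fin Cs] .
  have neC: "C \<noteq> {}" using subgroup.one_closed[OF Cs] by blast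
  obtain x where x: "x \<in> C" and xmax: "ord x = Max (ord ` C)"
    using Max_in[of "ord ` C"] finC neC by (metis empty_is_image finite_imageI imageE)
  have max: "ord y \<le> ord x" if "y \<in> C" for y
    unfolding xmax using that finC by (intro Max_ge) auto
  have xc: "x \<in> carrier G" using Cc[OF x] .
  have "y \<in> generate G {x}" if y: "y \<in> C" for y
  proof -
    have "y \<in> generate G {y}" by (simp add: generate.incl)
    moreover have "generate G {y} \<subseteq> generate G {x}"
      using chain[OF gC[OF y] gC[OF x]]
    proof
      assume le: "generate G {x} \<subseteq> generate G {y}"
      have "card (generate G {y}) \<le> card (generate G {x})"
        using max[OF y] generate_pow_card[OF xc] generate_pow_card[OF Cc[OF y]] by simp
      then show ?thesis using card_seteq[OF finite_subgroup[OF fin gC(1)[OF y]] le] by simp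
    qed
    ultimately show ?thesis by blast
  qed
  then have CX: "C = generate G {x}" using gC(2)[OF x] by blast
  have pow: "ord (x [^] (ord x div p)) = p" "x [^] (ord x div p) \<in> C" if "prime p" "p dvd ord x" for p :: nat
  proof -
    have "ord x > 0" using ord_ge_1[OF fin xc] by simp
    then have nz: "ord x div p \<noteq> 0" using that by (auto simp: dvd_div_eq_0_iff)
    have "ord x div p dvd ord x" using that(2) by (metis dvd_mult_div_cancel dvd_triv_right)
    then have "ord (x [^] (ord x div p)) = ord x div (ord x div p)"
      using ord_pow[OF xc _ nz] by blast
    then show "ord (x [^] (ord x div p)) = p"
      using that(2) nz by (metis dvd_mult_div_cancel nonzero_mult_div_cancel_right)
    show "x [^] (ord x div p) \<in> C" using subgroup_nat_pow_closed[OF Cs x] .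
  qed
  have "ord x > 0" using ord_ge_1[OF fin xc] by simp
  moreover have "p = q" if pq: "prime p" "prime q" "p dvd ord x" "q dvd ord x" for p q :: nat
  proof -
    let ?P = "generate G {x [^] (ord x div p)}" and ?Q = "generate G {x [^] (ord x div q)}"
    have cards: "card ?P = p" "card ?Q = q"
      using generate_pow_card[OF Cc[OF pow(2)]] pow pq by auto
    note Ps = gC[OF pow(2)[OF pq(1,3)]] and Qs = gC[OF pow(2)[OF pq(2,4)]]
    from chain[OF Ps Qs] have "p dvd q \<or> q dvd p"
      using card_subgroup_dvd[OF fin Ps(1) Qs(1)] card_subgroup_dvd[OF fin Qs(1) Ps(1)] cards by auto
    then show ?thesis using pq(1,2) primes_dvd_imp_eq by metis
  qed
  ultimately obtain p k where "prime p" "ord x = p ^ k"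
    using prime_powerI_nat by metis
  then show thesis using that xc CX by blast
qed

section \<open>Counting elements through the cyclic subgroups they generate\<close>

text \<open>The right-hand side is Euler's totient of \<open>ord x\<close>. Residues start at 0, so
  that order 1 yields exactly one generator.\<close>

lemma (in group) card_generators:
  assumes fin: "finite (carrier G)" and x: "x \<in> carrier G"
  shows "card {y \<in> carrier G. generate G {y} = generate G {x}} = card {i. i < ord x \<and> coprime i (ord x)}"
proof -
  have o1: "ord x \<ge> 1" using ord_ge_1[OF fin x] .
  have "bij_betw (\<lambda>i. x [^] i) {i. i < ord x \<and> coprime i (ord x)} {y \<in> carrier G. generate G {y} = generate G {x}}"
  proof (intro bij_betw_imageI)
    show "inj_on (\<lambda>i. x [^] i) {i. i < ord x \<and> coprime i (ord x)}"
      by (rule inj_on_subset[OF ord_inj[OF x]]) auto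
    show "(\<lambda>i. x [^] i) ` {i. i < ord x \<and> coprime i (ord x)} = {y \<in> carrier G. generate G {y} = generate G {x}}"
    proof (intro Set.set_eqI iffI)
      fix y assume "y \<in> (\<lambda>i. x [^] i) ` {i. i < ord x \<and> coprime i (ord x)}"
      then obtain i where i: "coprime i (ord x)" "y = x [^] i" by blast
      have yc: "y \<in> carrier G" using i x by simp
      have "ord y = ord x" using pow_ord_eq_ord_iff[OF fin x] i by simp
      then have "card (generate G {y}) = card (generate G {x})"
        using generate_pow_card[OF x] generate_pow_card[OF yc] by simp
      moreover have "generate G {y} \<subseteq> generate G {x}"
        using generate_singleton_subset_iff[OF generate_singleton_subgroup[OF x] yc]
          mem_generate_singleton_iff[OF fin x] i by blast
      ultimately have "generate G {y} = generate G {x}"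
        using card_subset_eq finite_subgroup[OF fin generate_singleton_subgroup[OF x]] by blast
      then show "y \<in> {y \<in> carrier G. generate G {y} = generate G {x}}" using yc by simp
    next
      fix y assume "y \<in> {y \<in> carrier G. generate G {y} = generate G {x}}"
      then have yc: "y \<in> carrier G" and eq: "generate G {y} = generate G {x}" by auto
      have "y \<in> generate G {x}" unfolding eq[symmetric] by (simp add: generate.incl)
      moreover have "{x [^] k |k. k \<in> (UNIV::nat set)} = {x [^] k |k. k \<in> {0..ord x - 1}}"
        using ord_elems[OF fin x] .
      ultimately obtain i where i: "i \<in> {0..ord x - 1}" "y = x [^] i"
        using generate_pow_on_finite_carrier[OF fin x] by auto
      have "ord y = ord x" using generate_pow_card[OF x] generate_pow_card[OF yc] eq by simp
      then have "coprime i (ord x)" using pow_ord_eq_ord_iff[OF fin x] i by simp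
      moreover have "i < ord x" using i(1) o1 by auto
      ultimately show "y \<in> (\<lambda>i. x [^] i) ` {i. i < ord x \<and> coprime i (ord x)}" using i(2) by blast
    qed
  qed
  then show ?thesis by (rule bij_betw_same_card[symmetric])
qed

definition torsion_cyclic_subgroups :: "('a, 'c) monoid_scheme \<Rightarrow> nat \<Rightarrow> 'a set set" where
  "torsion_cyclic_subgroups G n = (\<lambda>x. generate G {x}) ` {x \<in> carrier G. x [^]\<^bsub>G\<^esub> n = \<one>\<^bsub>G\<^esub>}"

text \<open>Solutions are sorted by the cyclic subgroup they generate. Being a solution depends only
  on the order, so each class consists of all generators of its subgroup, and its size depends only
  on the order of that subgroup.\<close>

lemma (in group) torsion_count_eq_sum:
  assumes fin: "finite (carrier G)"
  shows "torsion_count G n =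
    (\<Sum>C\<in>torsion_cyclic_subgroups G n. card {i. i < card C \<and> coprime i (card C)})"
proof -
  let ?S = "{x \<in> carrier G. x [^] n = \<one>}"
  have finS: "finite ?S" using fin by simp
  have "torsion_count G n = (\<Sum>x\<in>?S. 1)" by (simp add: torsion_count_def)
  also have "\<dots> = (\<Sum>C\<in>(\<lambda>x. generate G {x}) ` ?S. \<Sum>x\<in>{x. x \<in> ?S \<and> generate G {x} = C}. 1)"
    by (rule sum.image_gen[OF finS])
  also have "\<dots> = (\<Sum>C\<in>(\<lambda>x. generate G {x}) ` ?S. card {i. i < card C \<and> coprime i (card C)})"
  proof (rule sum.cong[OF refl])
    fix C assume "C \<in> (\<lambda>x. generate G {x}) ` ?S"
    then obtain x where x: "x \<in> carrier G" "x [^] n = \<one>" and C: "C = generate G {x}" by blast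
    have "{y. y \<in> ?S \<and> generate G {y} = C} = {y \<in> carrier G. generate G {y} = generate G {x}}"
    proof (intro Set.set_eqI iffI)
      fix y assume "y \<in> {y \<in> carrier G. generate G {y} = generate G {x}}"
      then have y: "y \<in> carrier G" "generate G {y} = generate G {x}" by auto
      then have "ord y = ord x" using generate_pow_card x(1) by metis
      then have "y [^] n = \<one>" using x y(1) pow_eq_id by metis
      then show "y \<in> {y. y \<in> ?S \<and> generate G {y} = C}" using y C by simp
    qed (use C in auto)
    then show "(\<Sum>x\<in>{x. x \<in> ?S \<and> generate G {x} = C}. 1) = card {i. i < card C \<and> coprime i (card C)}"
      using card_generators[OF fin x(1)] C generate_pow_card[OF x(1)] by simp
  qed
  finally show ?thesis by (simp add: torsion_cyclic_subgroups_def)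
qed

text \<open>This rewrites the index set of the sum in \<open>torsion_count_eq_sum\<close> in terms
  of chains and orders, the data that will be carried across a lattice isomorphism.\<close>

lemma (in group) torsion_cyclic_subgroups_prime_power:
  assumes fin: "finite (carrier G)" and p: "prime p"
  shows "torsion_cyclic_subgroups G (p ^ k) = {C. chain_subgroup G C \<and> card C dvd p ^ k}"
proof (intro Set.set_eqI iffI)
  fix C assume "C \<in> torsion_cyclic_subgroups G (p ^ k)"
  then obtain x where x: "x \<in> carrier G" "x [^] (p ^ k) = \<one>" and C: "C = generate G {x}"
    by (auto simp: torsion_cyclic_subgroups_def)
  then have d: "ord x dvd p ^ k" using pow_eq_id by blast
  then obtain i where "ord x = p ^ i" using divides_primepow_nat[OF p] by blast
  then show "C \<in> {C. chain_subgroup G C \<and> card C dvd p ^ k}"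
    using subgroups_below_cyclic_p_group[OF fin p x(1)] C d generate_pow_card[OF x(1)] by simp
next
  fix C assume "C \<in> {C. chain_subgroup G C \<and> card C dvd p ^ k}"
  then have "chain_subgroup G C" and d: "card C dvd p ^ k" by auto
  then obtain x where x: "x \<in> carrier G" and C: "C = generate G {x}"
    using chain_subgroupE[OF fin] by metis
  then have "x [^] (p ^ k) = \<one>" using pow_eq_id d generate_pow_card[OF x] by simp
  then show "C \<in> torsion_cyclic_subgroups G (p ^ k)"
    using x C by (auto simp: torsion_cyclic_subgroups_def)
qed

section \<open>Joins of two subgroups of prime order\<close>

lemma (in group) card_set_mult_disjoint:
  assumes P: "subgroup P G" and Q: "subgroup Q G" and PQ: "P \<inter> Q = {\<one>}"
  shows "card (P <#> Q) = card P * card Q"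
proof -
  interpret group_disjoint_sum G P Q
    using P Q by (simp add: group_disjoint_sum_def is_group)
  have "P <#> Q = (\<lambda>(x, y). x \<otimes> y) ` (P \<times> Q)"
    by (auto simp: set_mult_def)
  moreover have "inj_on (\<lambda>(x, y). x \<otimes> y) (P \<times> Q)"
    using cancel PQ unfolding inj_on_def by auto
  ultimately show ?thesis by (simp add: card_image card_cartesian_product)
qed

lemma (in group) subgroup_card_1: "subgroup P G \<Longrightarrow> card P = 1 \<Longrightarrow> P = {\<one>}"
  using subgroup.one_closed by (metis card_1_singletonE singletonD)

lemma (in group) prime_subgroups_disjoint:
  assumes fin: "finite (carrier G)" and P: "subgroup P G" and Q: "subgroup Q G"
    and p: "prime (card P)" and q: "prime (card Q)" and "P \<noteq> Q"
  shows "P \<inter> Q = {\<one>}"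
proof -
  have PQ: "subgroup (P \<inter> Q) G" using subgroups_Inter_pair[OF P Q] .
  have dP: "card (P \<inter> Q) dvd card P" and dQ: "card (P \<inter> Q) dvd card Q"
    using card_subgroup_dvd[OF fin PQ P] card_subgroup_dvd[OF fin PQ Q] by auto
  have "card (P \<inter> Q) = 1"
  proof (rule ccontr)
    assume "card (P \<inter> Q) \<noteq> 1"
    then have "card (P \<inter> Q) = card P" "card (P \<inter> Q) = card Q"
      using dP dQ p q prime_nat_iff by blast+
    then have "P \<inter> Q = P" "P \<inter> Q = Q"
      using card_subset_eq[OF finite_subgroup[OF fin P] Int_lower1]
        card_subset_eq[OF finite_subgroup[OF fin Q] Int_lower2] by blast+
    then show False using \<open>P \<noteq> Q\<close> by simp
  qed
  then show ?thesis using subgroup_card_1[OF PQ] by simp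
qed

lemma dvd_prime_product_nat:
  fixes p q r :: nat
  assumes "prime p" "prime q" "r dvd p * q" "r \<noteq> 1" "r \<noteq> p * q"
  shows "r = p \<or> r = q"
proof (cases "p dvd r")
  case True
  then obtain t where t: "r = p * t" by blast
  then have "t dvd q" using assms(1,3) by (simp add: prime_gt_0_nat)
  then have "t = 1 \<or> t = q" using assms(2) prime_nat_iff by blast
  then show ?thesis using t assms(5) by auto
next
  case False
  then have "coprime r p" using assms(1) by (simp add: coprime_commute prime_imp_coprime)
  then have "r dvd q" using assms(3) by (simp add: coprime_dvd_mult_right_iff)
  then show ?thesis using assms(2,4) prime_nat_iff by blast
qed

text \<open>Together with \<open>set_mult_subset_subgroup\<close> this identifies
  \<open>P <#> Q\<close> as the join of \<open>P\<close> and \<open>Q\<close> in the subgroup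
  lattice.\<close>

lemma (in comm_group) subset_set_mult:
  assumes P: "subgroup P G" and Q: "subgroup Q G"
  shows "P \<subseteq> P <#> Q" "Q \<subseteq> P <#> Q"
proof -
  show "P \<subseteq> P <#> Q"
  proof
    fix x assume x: "x \<in> P"
    then have "x = x \<otimes> \<one>" using subgroup.mem_carrier[OF P] by simp
    then show "x \<in> P <#> Q" using x subgroup.one_closed[OF Q] unfolding set_mult_def by blast
  qed
  show "Q \<subseteq> P <#> Q"
  proof
    fix x assume x: "x \<in> Q"
    then have "x = \<one> \<otimes> x" using subgroup.mem_carrier[OF Q] by simp
    then show "x \<in> P <#> Q" using x subgroup.one_closed[OF P] unfolding set_mult_def by blast
  qed
qed

lemma (in group) set_mult_subset_subgroup:
  assumes "subgroup R G" "P \<subseteq> R" "Q \<subseteq> R" shows "P <#> Q \<subseteq> R"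
  using assms subgroup.m_closed unfolding set_mult_def by fast

text \<open>By Lagrange, the proper nontrivial subgroups of the product have order
  \<open>card P\<close> or \<open>card Q\<close>; they form \<open>R\<close>. For distinct primes
  only \<open>P\<close> and \<open>Q\<close> remain. For a single prime p there are p + 1 of them,
  found by counting nonidentity elements.\<close>

lemma (in comm_group) card_subgroups_below_set_mult:
  assumes fin: "finite (carrier G)" and P: "subgroup P G" and Q: "subgroup Q G"
    and p: "prime (card P)" and q: "prime (card Q)" and ne: "P \<noteq> Q"
  shows "card (subgroups_below G (P <#> Q)) = (if card P = card Q then card P + 3 else 4)"
proof -
  let ?D = "P <#> Q"
  define R where "R = subgroups_below G ?D - {{\<one>}, ?D}"
  have Ds: "subgroup ?D G" using mult_subgroups[OF P Q] .
  have PQ: "P \<inter> Q = {\<one>}" using prime_subgroups_disjoint[OF fin P Q p q ne] .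
  have cD: "card ?D = card P * card Q" using card_set_mult_disjoint[OF P Q PQ] .
  have p1: "card P > 1" and q1: "card Q > 1" using p q prime_gt_1_nat by auto
  have less: "card P < card ?D" "card Q < card ?D" unfolding cD using p1 q1 by simp_all
  have one: "{\<one>} \<in> subgroups_below G ?D" and DD: "?D \<in> subgroups_below G ?D"
    using triv_subgroup subgroup.one_closed[OF Ds] Ds by (auto simp: subgroups_below_def)
  have D1: "?D \<noteq> {\<one>}" using less(1) p1 by auto
  have finR: "finite R" using finite_subgroups_below[OF fin] by (simp add: R_def)
  have "subgroups_below G ?D = insert {\<one>} (insert ?D R)" using one DD by (auto simp: R_def)
  moreover have "{\<one>} \<notin> insert ?D R" "?D \<notin> R" using D1 by (auto simp: R_def)
  ultimately have cardb: "card (subgroups_below G ?D) = card R + 2" using finR by simp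
  have memR: "A \<in> R \<longleftrightarrow> subgroup A G \<and> A \<subseteq> ?D \<and> (card A = card P \<or> card A = card Q)" for A
  proof
    assume "A \<in> R"
    then have A: "subgroup A G" "A \<subseteq> ?D" "A \<noteq> {\<one>}" "A \<noteq> ?D"
      by (auto simp: R_def subgroups_below_def)
    have "card A \<noteq> 1" using subgroup_card_1[OF A(1)] A(3) by blast
    moreover have "card A \<noteq> card ?D"
      using card_subset_eq[OF finite_subgroup[OF fin Ds] A(2)] A(4) by blast
    moreover have "card A dvd card P * card Q" using card_subgroup_dvd[OF fin A(1) Ds A(2)] cD by simp
    ultimately show "subgroup A G \<and> A \<subseteq> ?D \<and> (card A = card P \<or> card A = card Q)"
      using A dvd_prime_product_nat[OF p q] cD by auto
  next
    assume A: "subgroup A G \<and> A \<subseteq> ?D \<and> (card A = card P \<or> card A = card Q)"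
    then have "card A \<noteq> 1 \<and> card A \<noteq> card ?D" using less p1 q1 by (metis less_irrefl)
    then have "A \<noteq> {\<one>}" "A \<noteq> ?D" by fastforce+
    then show "A \<in> R" using A by (auto simp: R_def subgroups_below_def)
  qed
  show ?thesis
  proof (cases "card P = card Q")
    case False
    \<comment> \<open>A second subgroup \<open>B\<close> of the same order would give
      \<open>B <#> A\<close> of order (card A)^2 inside a group of order card P * card Q, so one of
      the two distinct primes would divide the other.\<close>
    have unique: "B = A" if A: "A \<in> {P, Q}" and B: "subgroup B G" "B \<subseteq> ?D" "card B = card A" for A B
    proof (rule ccontr)
      assume "B \<noteq> A"
      have As: "subgroup A G" "A \<subseteq> ?D" "prime (card A)"
        using A P Q p q subset_set_mult[OF P Q] by auto
      have BA: "subgroup (B <#> A) G" using mult_subgroups[OF B(1) As(1)] .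
      have "B \<inter> A = {\<one>}"
        using prime_subgroups_disjoint[OF fin B(1) As(1)] As(3) B(3) \<open>B \<noteq> A\<close> by simp
      then have "card (B <#> A) = card A * card A"
        using card_set_mult_disjoint[OF B(1) As(1)] B(3) by simp
      moreover have "B <#> A \<subseteq> ?D" using set_mult_subset_subgroup[OF Ds B(2) As(2)] .
      ultimately have "card A * card A dvd card P * card Q"
        using card_subgroup_dvd[OF fin BA Ds] cD by simp
      then have "card P dvd card Q \<or> card Q dvd card P"
        using A p1 q1 by auto
      then show False using False primes_dvd_imp_eq p q by metis
    qed
    have "A = P \<or> A = Q" if "A \<in> R" for A
      using memR that unique[of P A] unique[of Q A] by blast
    moreover have "P \<in> R" "Q \<in> R" using memR subset_set_mult[OF P Q] P Q by simp_all
    ultimately have "R = {P, Q}" by blast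
    then show ?thesis using cardb False ne by simp
  next
    case True
    have cR: "card A = card P" if "A \<in> R" for A using that memR True by auto
    have sR: "subgroup A G" if "A \<in> R" for A using that memR by blast
    \<comment> \<open>Every nonidentity element of the product has order p, so the subgroups of
      order p partition these p^2 - 1 elements into blocks of size p - 1.\<close>
    have "?D - {\<one>} = (\<Union>A\<in>R. A - {\<one>})"
    proof
      show "(\<Union>A\<in>R. A - {\<one>}) \<subseteq> ?D - {\<one>}" using memR by auto
      show "?D - {\<one>} \<subseteq> (\<Union>A\<in>R. A - {\<one>})"
      proof
        fix x assume x: "x \<in> ?D - {\<one>}"
        then obtain a b where ab: "a \<in> P" "b \<in> Q" "x = a \<otimes> b" unfolding set_mult_def by blast
        have c: "a \<in> carrier G" "b \<in> carrier G"
          using subgroup.mem_carrier[OF P ab(1)] subgroup.mem_carrier[OF Q ab(2)] by auto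
        then have xc: "x \<in> carrier G" using ab by simp
        have "generate G {a} \<subseteq> P" "generate G {b} \<subseteq> Q"
          using generate_singleton_subset_iff P Q c ab by auto
        then have "ord a dvd card P" "ord b dvd card P"
          using card_subgroup_dvd[OF fin generate_singleton_subgroup] P Q c True generate_pow_card
          by metis+
        then have "a [^] card P = \<one>" "b [^] card P = \<one>" using c pow_eq_id by auto
        then have "x [^] card P = \<one>" using c ab(3) by (simp add: nat_pow_distrib)
        then have "ord x dvd card P" using pow_eq_id[OF xc] by blast
        moreover have "ord x \<noteq> 1" using ord_eq_1[OF xc] x by blast
        ultimately have "ord x = card P" using p prime_nat_iff by blast
        moreover have "generate G {x} \<subseteq> ?D"
          using generate_singleton_subset_iff[OF Ds xc] x by blast
        ultimately have "generate G {x} \<in> R"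
          using memR generate_singleton_subgroup[OF xc] generate_pow_card[OF xc] by simp
        moreover have "x \<in> generate G {x} - {\<one>}" using x by (simp add: generate.incl)
        ultimately show "x \<in> (\<Union>A\<in>R. A - {\<one>})" by blast
      qed
    qed
    then have "card (?D - {\<one>}) = (\<Sum>A\<in>R. card (A - {\<one>}))"
    proof (simp only:, intro card_UN_disjoint finR ballI impI)
      fix A assume "A \<in> R"
      then show "finite (A - {\<one>})" using finite_subgroup[OF fin sR] by simp
    next
      fix A B assume "A \<in> R" "B \<in> R" "A \<noteq> B"
      then have "A \<inter> B = {\<one>}"
        using prime_subgroups_disjoint[OF fin sR sR] cR p by simp
      then show "(A - {\<one>}) \<inter> (B - {\<one>}) = {}" by blast
    qed
    also have "\<dots> = (\<Sum>A\<in>R. card P - 1)"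
      using cR finite_subgroup[OF fin sR] subgroup.one_closed[OF sR]
      by (intro sum.cong) (simp_all add: card_Diff_singleton)
    finally have e1: "card P * card P - 1 = card R * (card P - 1)"
      using cD True subgroup.one_closed[OF Ds] by (simp add: card_Diff_singleton)
    have e2: "card P * card P - 1 = (card P + 1) * (card P - 1)"
      by (simp add: algebra_simps)
    have "card R * (card P - 1) = (card P + 1) * (card P - 1)"
      using e1 e2 by (rule trans[OF sym])
    moreover have "card P - 1 \<noteq> 0" using p1 by simp
    ultimately have "card R = card P + 1" using mult_right_cancel by blast
    then show ?thesis using cardb True by simp
  qed
qed

section \<open>Isomorphisms of subgroup lattices\<close>

locale finite_abelian_lattice_iso = A: comm_group A + B: comm_group B
  for A :: "('a, 'c) monoid_scheme" and B :: "('b, 'd) monoid_scheme" +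
  fixes f :: "'a set \<Rightarrow> 'b set"
  assumes finA: "finite (carrier A)" and finB: "finite (carrier B)"
    and bij: "bij_betw f (subgroup_lattice A) (subgroup_lattice B)"
    and mono_iff: "\<And>P Q. subgroup P A \<Longrightarrow> subgroup Q A \<Longrightarrow> P \<subseteq> Q \<longleftrightarrow> f P \<subseteq> f Q"
begin

lemma subgroup_f: "subgroup P A \<Longrightarrow> subgroup (f P) B"
  using bij_betwE[OF bij] by (simp add: subgroup_lattice_def)

lemma f_surj:
  assumes "subgroup Q B" obtains P where "subgroup P A" "Q = f P"
  using assms bij_betw_imp_surj_on[OF bij] by (auto simp: subgroup_lattice_def)

lemma f_inj: "subgroup P A \<Longrightarrow> subgroup Q A \<Longrightarrow> f P = f Q \<longleftrightarrow> P = Q"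
  using mono_iff by blast

lemma subgroups_below_f:
  assumes P: "subgroup P A" shows "subgroups_below B (f P) = f ` subgroups_below A P"
proof (intro Set.set_eqI iffI)
  fix Q assume "Q \<in> subgroups_below B (f P)"
  then have Q: "subgroup Q B" "Q \<subseteq> f P" by (auto simp: subgroups_below_def)
  obtain R where R: "subgroup R A" "Q = f R" using f_surj[OF Q(1)] .
  then show "Q \<in> f ` subgroups_below A P"
    using mono_iff[OF R(1) P] Q(2) by (auto simp: subgroups_below_def)
next
  fix Q assume "Q \<in> f ` subgroups_below A P"
  then show "Q \<in> subgroups_below B (f P)"
    using mono_iff[OF _ P] subgroup_f by (auto simp: subgroups_below_def)
qed

lemma card_subgroups_below_f:
  assumes P: "subgroup P A" shows "card (subgroups_below B (f P)) = card (subgroups_below A P)"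
  unfolding subgroups_below_f[OF P]
  by (rule card_image) (auto simp: inj_on_def f_inj subgroups_below_def)

lemma chain_subgroup_f:
  assumes P: "subgroup P A" shows "chain_subgroup B (f P) \<longleftrightarrow> chain_subgroup A P"
proof -
  have *: "f Q \<subseteq> f R \<or> f R \<subseteq> f Q \<longleftrightarrow> Q \<subseteq> R \<or> R \<subseteq> Q"
    if "Q \<in> subgroups_below A P" "R \<in> subgroups_below A P" for Q R
    using that mono_iff by (simp add: subgroups_below_def)
  then show ?thesis
    unfolding chain_subgroup_def subgroups_below_f[OF P]
    by (simp add: P subgroup_f[OF P] * cong: ball_cong)
qed

text \<open>An order isomorphism preserves joins: by surjectivity the join in \<open>B\<close> is
  some \<open>f D\<close>, and \<open>D\<close> contains \<open>P\<close> and \<open>Q\<close>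
  because inclusions are reflected.\<close>

lemma f_set_mult:
  assumes P: "subgroup P A" and Q: "subgroup Q A"
  shows "f (P <#>\<^bsub>A\<^esub> Q) = f P <#>\<^bsub>B\<^esub> f Q"
proof
  have PQ: "subgroup (P <#>\<^bsub>A\<^esub> Q) A" using A.mult_subgroups[OF P Q] .
  have fPQ: "subgroup (f P <#>\<^bsub>B\<^esub> f Q) B"
    using B.mult_subgroups[OF subgroup_f[OF P] subgroup_f[OF Q]] .
  obtain D where D: "subgroup D A" "f P <#>\<^bsub>B\<^esub> f Q = f D" using f_surj[OF fPQ] .
  have "P \<subseteq> D" "Q \<subseteq> D"
    using B.subset_set_mult[OF subgroup_f[OF P] subgroup_f[OF Q]] mono_iff P Q D by simp_all
  then have "P <#>\<^bsub>A\<^esub> Q \<subseteq> D" using A.set_mult_subset_subgroup[OF D(1)] by blast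
  then show "f (P <#>\<^bsub>A\<^esub> Q) \<subseteq> f P <#>\<^bsub>B\<^esub> f Q" using mono_iff[OF PQ D(1)] D(2) by simp
  show "f P <#>\<^bsub>B\<^esub> f Q \<subseteq> f (P <#>\<^bsub>A\<^esub> Q)"
    using B.set_mult_subset_subgroup[OF subgroup_f[OF PQ]] mono_iff[OF P PQ] mono_iff[OF Q PQ]
      A.subset_set_mult[OF P Q] by simp
qed

text \<open>The number of subgroups, k + 1, is preserved and fixes the exponent; the prime may still
  change from p to q.\<close>

lemma chain_f_generator:
  assumes P: "subgroup P A" and x: "x \<in> carrier A" "prime p" "A.ord x = p ^ k" "P = generate A {x}"
  obtains y q where "y \<in> carrier B" "prime q" "B.ord y = q ^ k" "f P = generate B {y}"
proof -
  have ch: "chain_subgroup A P" "card (subgroups_below A P) = Suc k"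
    using A.subgroups_below_cyclic_p_group[OF finA x(2,1,3)] x(4) by auto
  then have "chain_subgroup B (f P)" using chain_subgroup_f[OF P] by simp
  then obtain y q j where y: "y \<in> carrier B" "prime q" "B.ord y = q ^ j" "f P = generate B {y}"
    by (rule B.chain_subgroupE[OF finB]) blast
  have "Suc j = Suc k"
    using B.subgroups_below_cyclic_p_group[OF finB y(2,1,3)] y(4) ch(2) card_subgroups_below_f[OF P] by simp
  then show thesis using that y by simp
qed

text \<open>With p = \<open>card P\<close>, the join of \<open>P\<close> and \<open>Q\<close> has p
  + 3 subgroups. Its image is the join of two distinct subgroups of prime order and so has either 4
  subgroups or three more than the order of \<open>f P\<close>. Since p > 1, the value 4 is
  impossible.\<close>

lemma card_f_prime:
  assumes P: "subgroup P A" "prime (card P)" and Q: "subgroup Q A" "card Q = card P" "P \<noteq> Q"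
  shows "card (f P) = card P"
proof -
  \<comment> \<open>A subgroup of prime order is cyclic with exponent 1, so its image has prime
    order, though possibly for another prime.\<close>
  have pr: "prime (card (f S))" if S: "subgroup S A" "prime (card S)" for S
  proof -
    obtain x where x: "x \<in> S" "x \<noteq> \<one>\<^bsub>A\<^esub>"
      using S(2) prime_gt_1_nat[OF S(2)] subgroup.one_closed[OF S(1)]
      by (metis card_1_singleton_iff is_singletonI' is_singleton_altdef less_irrefl empty_iff One_nat_def)
    have xc: "x \<in> carrier A" using subgroup.mem_carrier[OF S(1) x(1)] .
    have xS: "generate A {x} \<subseteq> S" using A.generate_singleton_subset_iff[OF S(1) xc] x(1) by simp
    then have "A.ord x dvd card S"
      using A.card_subgroup_dvd[OF finA A.generate_singleton_subgroup[OF xc] S(1)] A.generate_pow_card[OF xc] by simp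
    moreover have "A.ord x \<noteq> 1" using A.ord_eq_1[OF xc] x(2) by simp
    ultimately have o: "A.ord x = card S" using S(2) prime_nat_iff by blast
    then have "S = generate A {x}"
      using card_subset_eq[OF A.finite_subgroup[OF finA S(1)] xS] A.generate_pow_card[OF xc] by simp
    moreover have "A.ord x = card S ^ 1" using o by simp
    ultimately obtain y q where "y \<in> carrier B" "prime q" "B.ord y = q ^ 1" "f S = generate B {y}"
      using chain_f_generator[OF S(1) xc S(2)] by metis
    then show ?thesis using B.generate_pow_card by simp
  qed
  have pP: "prime (card (f P))" and pQ: "prime (card (f Q))" using pr P Q by auto
  have ne: "f P \<noteq> f Q" using f_inj P(1) Q(1,3) by blast
  have "card (subgroups_below B (f P <#>\<^bsub>B\<^esub> f Q)) = card (subgroups_below A (P <#>\<^bsub>A\<^esub> Q))"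
    using card_subgroups_below_f[OF A.mult_subgroups[OF P(1) Q(1)]] f_set_mult[OF P(1) Q(1)] by simp
  also have "\<dots> = card P + 3"
    using A.card_subgroups_below_set_mult[OF finA P(1) Q(1) P(2) _ Q(3)] Q(2) P(2) by simp
  finally have "(if card (f P) = card (f Q) then card (f P) + 3 else 4) = card P + 3"
    using B.card_subgroups_below_set_mult[OF finB subgroup_f[OF P(1)] subgroup_f[OF Q(1)] pP pQ ne] by simp
  then show ?thesis using prime_gt_1_nat[OF P(2)] by (simp split: if_splits)
qed

end

text \<open>The assumption rules out a sole subgroup of order p, where the lattice may hide p: all
  groups of prime order have isomorphic subgroup lattices.\<close>

locale rank_two_lattice_iso = finite_abelian_lattice_iso +
  assumes rank_two: "\<And>P. subgroup P A \<Longrightarrow> prime (card P) \<Longrightarrow>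
    \<exists>Q. subgroup Q A \<and> card Q = card P \<and> P \<noteq> Q"
begin

text \<open>Only the prime could change, by \<open>chain_f_generator\<close>. The subgroup of order
  p inside \<open>C\<close> keeps its order by \<open>card_f_prime\<close>, and its image lies in
  \<open>f C\<close> of order q^k; hence p = q.\<close>

lemma card_f_chain:
  assumes C: "chain_subgroup A C" shows "card (f C) = card C"
proof -
  obtain x p k where x: "x \<in> carrier A" "prime p" "A.ord x = p ^ k" "C = generate A {x}"
    using A.chain_subgroupE[OF finA C] .
  have Cs: "subgroup C A" using C by (simp add: chain_subgroup_def)
  obtain y q where y: "y \<in> carrier B" "prime q" "B.ord y = q ^ k" "f C = generate B {y}"
    using chain_f_generator[OF Cs x] .
  have cards: "card C = p ^ k" "card (f C) = q ^ k"
    using A.generate_pow_card[OF x(1)] B.generate_pow_card[OF y(1)] x y by auto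
  show ?thesis
  proof (cases k)
    case 0
    then show ?thesis using cards by simp
  next
    case (Suc j)
    have nz: "p ^ j \<noteq> 0" using prime_gt_0_nat[OF x(2)] by simp
    let ?z = "x [^]\<^bsub>A\<^esub> (p ^ j)"
    have zc: "?z \<in> carrier A" using x(1) by simp
    have "A.ord ?z = A.ord x div p ^ j" by (rule A.ord_pow[OF x(1) _ nz]) (simp add: x(3) Suc)
    then have ordz: "A.ord ?z = p" using x(3) Suc nz by simp
    let ?P = "generate A {?z}"
    have Ps: "subgroup ?P A" and cP: "card ?P = p"
      using A.generate_singleton_subgroup[OF zc] A.generate_pow_card[OF zc] ordz by auto
    obtain Q where "subgroup Q A" "card Q = card ?P" "?P \<noteq> Q"
      using rank_two[OF Ps] x(2) unfolding cP by blast
    then have cfP: "card (f ?P) = p" using card_f_prime[OF Ps] cP x(2) by simp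
    have "?P \<subseteq> C"
      unfolding x(4) using A.generate_singleton_subset_iff[OF A.generate_singleton_subgroup[OF x(1)] zc]
        A.mem_generate_singleton_iff[OF finA x(1)] by blast
    then have "f ?P \<subseteq> f C" using mono_iff[OF Ps Cs] by simp
    then have "p dvd q ^ k"
      using B.card_subgroup_dvd[OF finB subgroup_f[OF Ps] subgroup_f[OF Cs]] cfP cards by simp
    then have "p = q" using x(2) y(2) prime_dvd_power primes_dvd_imp_eq by blast
    then show ?thesis using cards by simp
  qed
qed

text \<open>\<open>f\<close> maps the chain subgroups of order dividing \<open>p ^ k\<close>
  bijectively onto those of the other group and keeps their orders, so the two sums from
  \<open>torsion_count_eq_sum\<close> agree term by term.\<close>

lemma torsion_count_prime_power_eq:
  assumes p: "prime p" shows "torsion_count A (p ^ k) = torsion_count B (p ^ k)"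
proof -
  let ?S = "{C. chain_subgroup A C \<and> card C dvd p ^ k}"
  have SA: "subgroup C A" if "C \<in> ?S" for C using that by (simp add: chain_subgroup_def)
  have img: "f ` ?S = {C. chain_subgroup B C \<and> card C dvd p ^ k}"
  proof (intro Set.set_eqI iffI)
    fix D assume "D \<in> f ` ?S"
    then show "D \<in> {C. chain_subgroup B C \<and> card C dvd p ^ k}"
      using chain_subgroup_f[OF SA] card_f_chain by auto
  next
    fix D assume D: "D \<in> {C. chain_subgroup B C \<and> card C dvd p ^ k}"
    then have "subgroup D B" by (simp add: chain_subgroup_def)
    then obtain C where C: "subgroup C A" "D = f C" using f_surj by blast
    then have "chain_subgroup A C" using chain_subgroup_f[OF C(1)] D by simp
    then show "D \<in> f ` ?S" using C D card_f_chain by auto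
  qed
  have "inj_on f ?S" using f_inj SA by (auto simp: inj_on_def)
  then have "torsion_count B (p ^ k) = (\<Sum>C\<in>?S. card {i. i < card (f C) \<and> coprime i (card (f C))})"
    unfolding B.torsion_count_eq_sum[OF finB] B.torsion_cyclic_subgroups_prime_power[OF finB p] img[symmetric]
    by (simp add: sum.reindex)
  also have "\<dots> = torsion_count A (p ^ k)"
    unfolding A.torsion_count_eq_sum[OF finA] A.torsion_cyclic_subgroups_prime_power[OF finA p]
    by (rule sum.cong) (simp_all add: card_f_chain)
  finally show ?thesis by simp
qed

end

section \<open>Direct powers\<close>

lemma comm_group_group_power:
  assumes "comm_group G" shows "comm_group (group_power G n)"
proof -
  interpret comm_group G by fact
  have "group (group_power G n)" by (simp add: group_power_def)
  then show ?thesis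
    by (rule group.group_comm_groupI) (auto simp: group_power_def PiE_iff m_comm intro!: restrict_ext)
qed

lemma finite_group_power: "finite (carrier G) \<Longrightarrow> finite (carrier (group_power G n))"
  by (simp add: group_power_def finite_PiE)

lemma torsion_count_group_power: "torsion_count (group_power G n) q = torsion_count G q ^ n"
  by (simp add: group_power_def torsion_count_product_group)

text \<open>If \<open>P\<close> were the only subgroup of order \<open>p\<close> then the group would have exactly \<open>p\<close> elements of
  order dividing \<open>p\<close>; but a power has at least \<open>p\<^sup>n\<close> of them.\<close>
lemma group_power_second_prime_subgroup:
  assumes G: "comm_group G" and fin: "finite (carrier G)" and n: "n \<ge> 2"
    and P: "subgroup P (group_power G n)" "prime (card P)"
  shows "\<exists>Q. subgroup Q (group_power G n) \<and> card Q = card P \<and> P \<noteq> Q"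
proof (rule ccontr)
  assume no: "\<not> ?thesis"
  interpret G: comm_group G by fact
  interpret K: comm_group "group_power G n" using comm_group_group_power[OF G] .
  have finK: "finite (carrier (group_power G n))" using finite_group_power[OF fin] .
  define p where "p = card P"
  have p: "prime p" using P by (simp add: p_def)
  let ?T = "{x \<in> carrier (group_power G n). x [^]\<^bsub>group_power G n\<^esub> p = \<one>\<^bsub>group_power G n\<^esub>}"
  have "?T = P"
  proof
    show "P \<subseteq> ?T"
    proof
      fix x assume x: "x \<in> P"
      then have xc: "x \<in> carrier (group_power G n)" using subgroup.mem_carrier[OF P(1)] by blast
      have "K.ord x dvd p"
        using K.card_subgroup_dvd[OF finK K.generate_singleton_subgroup[OF xc] P(1)]
          K.generate_singleton_subset_iff[OF P(1) xc] x K.generate_pow_card[OF xc] by (simp add: p_def)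
      then show "x \<in> ?T" using xc K.pow_eq_id by simp
    qed
    show "?T \<subseteq> P"
    proof
      fix x assume "x \<in> ?T"
      then have xc: "x \<in> carrier (group_power G n)" and d: "K.ord x dvd p" using K.pow_eq_id by auto
      then consider "K.ord x = 1" | "K.ord x = p" using p prime_nat_iff by blast
      then show "x \<in> P"
      proof cases
        case 1
        then show ?thesis using K.ord_eq_1[OF xc] subgroup.one_closed[OF P(1)] by simp
      next
        case 2
        then have "generate (group_power G n) {x} = P"
          using no K.generate_singleton_subgroup[OF xc] K.generate_pow_card[OF xc] by (auto simp: p_def)
        then show ?thesis using generate.incl[of x "{x}"] by blast
      qed
    qed
  qed
  \<comment> \<open>The contradiction is arithmetical: a prime is not an n-th power of a natural
    number when n is at least 2.\<close>
  then have cT: "torsion_count G p ^ n = p"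
    using torsion_count_group_power[of G n p] by (simp add: torsion_count_def p_def)
  have "torsion_count G p \<noteq> 1" using cT p by auto
  then have "prime (torsion_count G p ^ n)" "n \<noteq> 1" using cT p n by auto
  then show False using prime_power_iff by blast
qed

section \<open>Arithmetic of the exponents\<close>

text \<open>For a > 1, comparing equation i with equation 0 gives m_i * n_0 = n_i * m_0. Taking the
  gcd over all i, with d the common gcd, gives n_0 * d = m_0 * d. So n_0 = m_0, and equation 0
  yields a = b.\<close>

lemma power_eq_Gcd_imp_base_eq:
  fixes a b :: nat and m n :: "nat \<Rightarrow> nat"
  assumes "a > 0" "b > 0" and r: "r \<ge> 1" and pos: "\<And>i. i < r \<Longrightarrow> m i > 0 \<and> n i > 0"
    and gcd: "Gcd (m ` {..<r}) = Gcd (n ` {..<r})"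
    and eq: "\<And>i. i < r \<Longrightarrow> a ^ m i = b ^ n i"
  shows "a = b"
proof (cases "a = 1")
  case True
  then have "b ^ n 0 = 1" using eq[of 0] r by simp
  then show ?thesis using True pos[of 0] r by (simp add: power_eq_1_iff)
next
  case False
  have cross: "m i * n 0 = n i * m 0" if i: "i < r" for i
  proof -
    have "a ^ (m i * n 0) = (b ^ n i) ^ n 0" using eq[OF i] by (simp only: power_mult)
    also have "\<dots> = (b ^ n 0) ^ n i" by (simp only: power_mult[symmetric] mult.commute)
    also have "b ^ n 0 = a ^ m 0" using eq[of 0] r by simp
    also have "(a ^ m 0) ^ n i = a ^ (n i * m 0)" by (simp only: power_mult[symmetric] mult.commute)
    finally show ?thesis using False \<open>a > 0\<close> by simp
  qed
  have "n 0 * Gcd (m ` {..<r}) = Gcd ((*) (n 0) ` m ` {..<r})" by (simp add: Gcd_mult)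
  also have "(*) (n 0) ` m ` {..<r} = (*) (m 0) ` n ` {..<r}"
    using cross by (auto simp: image_image mult.commute intro!: image_cong)
  also have "Gcd \<dots> = m 0 * Gcd (m ` {..<r})" using gcd by (simp add: Gcd_mult)
  finally have "n 0 * Gcd (m ` {..<r}) = m 0 * Gcd (m ` {..<r})" .
  moreover have "Gcd (m ` {..<r}) \<noteq> 0"
  proof -
    have "m 0 \<in> m ` {..<r}" "m 0 \<noteq> 0" using r pos[of 0] by auto
    then show ?thesis by (auto simp: Gcd_0_iff)
  qed
  ultimately have "n 0 = m 0" by simp
  then have "a ^ m 0 = b ^ m 0" "m 0 > 0" using eq[of 0] pos[of 0] r by auto
  then show ?thesis using power_eq_iff_eq_base by blast
qed

section \<open>Isomorphic groups and the final equivalence\<close>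

lemma iso_imp_subgroup_lattice_iso:
  assumes "group K" "group M" "K \<cong> M" shows "subgroup_lattice_iso K M"
proof -
  interpret K: group K by fact
  interpret M: group M by fact
  obtain h where h: "h \<in> iso K M" using assms(3) by (auto simp: is_iso_def)
  interpret h: group_hom K M h
    using h by (simp add: group_hom_def group_hom_axioms_def iso_def K.is_group M.is_group)
  have bij: "bij_betw h (carrier K) (carrier M)" using h by (simp add: iso_def)
  define g where "g = inv_into (carrier K) h"
  have g: "g \<in> iso M K" unfolding g_def using K.iso_set_sym[OF h] .
  interpret g: group_hom M K g
    using g by (simp add: group_hom_def group_hom_axioms_def iso_def K.is_group M.is_group)
  have gh: "g ` h ` A = A" if "subgroup A K" for A
    unfolding g_def using subgroup.subset[OF that] bij_betw_imp_inj_on[OF bij] by (rule inv_into_image_cancel[rotated])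
  have hg: "h ` g ` A = A" if "subgroup A M" for A
    unfolding g_def using bij_betw_imp_surj_on[OF bij] subgroup.subset[OF that] by (rule image_inv_into_cancel)
  have "bij_betw (\<lambda>A. h ` A) (subgroup_lattice K) (subgroup_lattice M)"
  proof (rule bij_betw_byWitness[where f' = "\<lambda>A. g ` A"])
    show "\<forall>A\<in>subgroup_lattice K. g ` h ` A = A" "\<forall>A\<in>subgroup_lattice M. h ` g ` A = A"
      by (intro ballI gh hg; simp only: subgroup_lattice_def mem_Collect_eq)+
    show "(\<lambda>A. h ` A) ` subgroup_lattice K \<subseteq> subgroup_lattice M"
      "(\<lambda>A. g ` A) ` subgroup_lattice M \<subseteq> subgroup_lattice K"
      unfolding subgroup_lattice_def using h.subgroup_img_is_subgroup g.subgroup_img_is_subgroup by blast+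
  qed
  moreover have "A \<subseteq> B \<longleftrightarrow> h ` A \<subseteq> h ` B" if "subgroup A K" "subgroup B K" for A B
    using gh[OF that(1)] gh[OF that(2)] image_mono by metis
  ultimately show ?thesis unfolding subgroup_lattice_iso_def
    by (intro exI[of _ "\<lambda>A. h ` A"]) (simp add: subgroup_lattice_def)
qed

theorem theorem3:
  fixes G :: "'a monoid" and H :: "'b monoid"
  assumes "comm_group G" and "finite (carrier G)"
      and "comm_group H" and "finite (carrier H)"
  shows "G \<cong> H \<longleftrightarrow>
    (\<exists>(r::nat) (m::nat \<Rightarrow> nat) (n::nat \<Rightarrow> nat).
        r \<ge> 1 \<and> (\<forall>i<r. m i \<ge> 2 \<and> n i \<ge> 2) \<and>
        Gcd (m ` {..<r}) = Gcd (n ` {..<r}) \<and>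
        (\<forall>i<r. subgroup_lattice_iso (group_power G (m i)) (group_power H (n i))))"
    (is "_ \<longleftrightarrow> ?R")
proof
  interpret G: comm_group G by fact
  interpret H: comm_group H by fact
  {
    assume "G \<cong> H"
    then have "group_power G 2 \<cong> group_power H 2"
      unfolding group_power_def by (intro iso_product_groupI) auto
    then have "subgroup_lattice_iso (group_power G 2) (group_power H 2)"
      by (intro iso_imp_subgroup_lattice_iso) (simp_all add: group_power_def)
    \<comment> \<open>A single pair of exponents, both equal to 2, is enough.\<close>
    then show ?R
      by (intro exI[of _ "1::nat"] exI[of _ "\<lambda>_. 2::nat"]) simp
  next
    assume ?R
    then obtain r m n where r: "r \<ge> 1" and ge2: "\<And>i. i < r \<Longrightarrow> m i \<ge> 2 \<and> n i \<ge> 2"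
      and gcd: "Gcd (m ` {..<r}) = Gcd (n ` {..<r::nat})"
      and lattice: "\<And>i. i < r \<Longrightarrow> subgroup_lattice_iso (group_power G (m i)) (group_power H (n i))"
      by blast
    show "G \<cong> H"
    proof (rule iso_of_torsion_counts[OF assms])
      fix p k :: nat assume p: "prime p"
      have powers: "torsion_count G (p ^ k) ^ m i = torsion_count H (p ^ k) ^ n i" if i: "i < r" for i
      proof -
        let ?A = "group_power G (m i)" and ?B = "group_power H (n i)"
        obtain f where bij: "bij_betw f (subgroup_lattice ?A) (subgroup_lattice ?B)"
          and mono: "\<forall>P\<in>subgroup_lattice ?A. \<forall>Q\<in>subgroup_lattice ?A. P \<subseteq> Q \<longleftrightarrow> f P \<subseteq> f Q"
          using lattice[OF i] unfolding subgroup_lattice_iso_def by (elim exE conjE)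
        interpret A: comm_group ?A using comm_group_group_power[OF assms(1)] .
        interpret B: comm_group ?B using comm_group_group_power[OF assms(3)] .
        interpret rank_two_lattice_iso ?A ?B f
        proof
          show "finite (carrier ?A)" "finite (carrier ?B)"
            using finite_group_power assms(2,4) by blast+
          show "P \<subseteq> Q \<longleftrightarrow> f P \<subseteq> f Q" if "subgroup P ?A" "subgroup Q ?A" for P Q
            using mono that unfolding subgroup_lattice_def by blast
          \<comment> \<open>Here the bound \<open>m i \<ge> 2\<close> enters: a proper power has a
            second subgroup of each prime order that occurs.\<close>
          show "\<exists>Q. subgroup Q ?A \<and> card Q = card P \<and> P \<noteq> Q" if "subgroup P ?A" "prime (card P)" for P
            using group_power_second_prime_subgroup[OF assms(1,2) _ that] ge2[OF i] by blast
        qed (rule bij)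
        show ?thesis
          using torsion_count_prime_power_eq[OF p] by (simp add: torsion_count_group_power)
      qed
      show "torsion_count G (p ^ k) = torsion_count H (p ^ k)"
      proof (rule power_eq_Gcd_imp_base_eq[OF _ _ r _ gcd])
        show "torsion_count G (p ^ k) > 0" "torsion_count H (p ^ k) > 0"
          using G.torsion_count_pos[OF assms(2)] H.torsion_count_pos[OF assms(4)] by auto
        show "m i > 0 \<and> n i > 0" if "i < r" for i using ge2[OF that] by auto
      qed (rule powers)
    qed
  }
qed

end
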